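(* Let $S\in\mathsf{DS}$ and let $U$ be a proper subsemigroup of $S$. Then the inclusion embedding of $U$ in $S$ is not an epimorphism in $\mathsf{DS}$; that is, there exist a semigroup $R\in\mathsf{DS}$ and two distinct homomorphisms $\beta,\gamma:S\to R$ which coincide on $U$.
   Context: $\mathsf{DS}$ is the class (a pseudovariety) of all finite semigroups in which every regular $\mathcal{D}$-class is a subsemigroup, viewed as a category with all semigroup homomorphisms between its members as morphisms. A morphism $\alpha$ of a category is an epimorphism if, for all morphisms $\beta,\gamma$ of the category composable after $\alpha$, equality of the composites ($\alpha$ followed by $\beta$ equals $\alpha$ followed by $\gamma$) implies $\beta=\gamma$. A $\mathcal{D}$-class is regular if it consists of regular elements ($s$ is regular if $s=sts$ for some $t$). *)

theory Defs
  imports "HOL-Algebra.Congruence"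
begin

record 'a sgrp = "'a partial_object" +
  mul :: "'a \<Rightarrow> 'a \<Rightarrow> 'a"  (infixl \<open>\<cdot>\<index>\<close> 70)

locale semigrp =
  fixes S :: "'a sgrp" (structure)
  assumes closed: "\<lbrakk>x \<in> carrier S; y \<in> carrier S\<rbrakk> \<Longrightarrow> x \<cdot> y \<in> carrier S"
    and assoc: "\<lbrakk>x \<in> carrier S; y \<in> carrier S; z \<in> carrier S\<rbrakk>
      \<Longrightarrow> (x \<cdot> y) \<cdot> z = x \<cdot> (y \<cdot> z)"

definition subsemigroup :: "'a set \<Rightarrow> 'a sgrp \<Rightarrow> bool" where
  "subsemigroup U S \<longleftrightarrow> U \<subseteq> carrier S \<and> (\<forall>x\<in>U. \<forall>y\<in>U. x \<cdot>\<^bsub>S\<^esub> y \<in> U)"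

text \<open>The inserted generator accounts for the adjoined identity in \<open>S\<^sup>1 a\<close> and \<open>a S\<^sup>1\<close>.\<close>

definition lideal :: "'a sgrp \<Rightarrow> 'a \<Rightarrow> 'a set" where
  "lideal S a = insert a {s \<cdot>\<^bsub>S\<^esub> a | s. s \<in> carrier S}"

definition rideal :: "'a sgrp \<Rightarrow> 'a \<Rightarrow> 'a set" where
  "rideal S a = insert a {a \<cdot>\<^bsub>S\<^esub> s | s. s \<in> carrier S}"

definition green_L :: "'a sgrp \<Rightarrow> 'a rel" where
  "green_L S = {(a, b). a \<in> carrier S \<and> b \<in> carrier S \<and> lideal S a = lideal S b}"

definition green_R :: "'a sgrp \<Rightarrow> 'a rel" where
  "green_R S = {(a, b). a \<in> carrier S \<and> b \<in> carrier S \<and> rideal S a = rideal S b}"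

definition green_D :: "'a sgrp \<Rightarrow> 'a rel" where
  "green_D S = green_L S O green_R S"

definition regular :: "'a sgrp \<Rightarrow> 'a \<Rightarrow> bool" where
  "regular S s \<longleftrightarrow> s \<in> carrier S \<and> (\<exists>t\<in>carrier S. s = s \<cdot>\<^bsub>S\<^esub> t \<cdot>\<^bsub>S\<^esub> s)"

definition DS :: "'a sgrp set" where
  "DS = {S. semigrp S \<and> finite (carrier S) \<and>
     (\<forall>D \<in> carrier S // green_D S. (\<forall>s\<in>D. regular S s) \<longrightarrow> subsemigroup D S)}"

text \<open>Homomorphisms are extensional outside the carrier, so that HOL equality of
  homomorphisms is equality of morphisms.\<close>

definition sgrp_hom :: "'a sgrp \<Rightarrow> 'b sgrp \<Rightarrow> ('a \<Rightarrow> 'b) set" where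
  "sgrp_hom S T = {h \<in> carrier S \<rightarrow>\<^sub>E carrier T.
     \<forall>x\<in>carrier S. \<forall>y\<in>carrier S. h (x \<cdot>\<^bsub>S\<^esub> y) = h x \<cdot>\<^bsub>T\<^esub> h y}"

text \<open>\<open>DS_epi S T \<alpha>\<close>: the morphism \<open>\<alpha> : S \<rightarrow> T\<close> of \<open>DS\<close> is right cancellable in \<open>DS\<close>
  (composites are read left to right; \<open>compose\<close> applies its last argument first).
  The members of \<open>DS\<close> are finite, so each is isomorphic to one with carrier a set of
  natural numbers, and it suffices to let \<open>R\<close> range over these.\<close>

definition DS_epi :: "'a sgrp \<Rightarrow> 'b sgrp \<Rightarrow> ('a \<Rightarrow> 'b) \<Rightarrow> bool" where
  "DS_epi S T \<alpha> \<longleftrightarrow>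
    (\<forall>R \<in> (DS :: nat sgrp set). \<forall>\<beta> \<in> sgrp_hom T R. \<forall>\<gamma> \<in> sgrp_hom T R.
       compose (carrier S) \<beta> \<alpha> = compose (carrier S) \<gamma> \<alpha> \<longrightarrow> \<beta> = \<gamma>)"

end

theory Submission
  imports Defs "HOL-Library.Countable_Set"
begin

text \<open>A finite semigroup is in \<open>DS\<close> iff for each idempotent \<open>e\<close> the elements \<open>s\<close> with
  \<open>e \<in> S s S\<close> form a subsemigroup. This condition is self-dual and lifts along a surjection
  \<open>\<pi> : T \<rightarrow> S\<close> as soon as \<open>e\<close> idempotent, \<open>x = e x = x e\<close> and \<open>\<pi> x = \<pi> e\<close> imply
  \<open>e \<in> x T\<close>.

  One may assume that \<open>S\<close> is a monoid and \<open>U\<close> a maximal proper submonoid, so that \<open>S - U\<close> lies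
  in a single \<open>\<J>\<close>-class \<open>J\<close>. Two copies of \<open>S\<close> glued along \<open>U\<close> become a member of \<open>DS\<close> by
  putting a product outside \<open>U\<close> into the copy of its rightmost factor outside \<open>U\<close>, unless
  this is not associative; dually for leftmost factors. If both fail, then \<open>J\<close> is regular and
  \<open>U\<close> meets every \<open>\<L>\<close>-class and every \<open>\<R>\<close>-class of \<open>J\<close>. Then right multiplication by
  an element of \<open>U\<close> above \<open>J\<close> takes \<open>J \<inter> U\<close> and its complement in \<open>J\<close> to themselves, and an inner derivation
  of \<open>S\<close> with values in the power set of \<open>J\<close> vanishes on \<open>U\<close> but not on \<open>S\<close>.\<close>

section \<open>Idempotents and membership in \<open>DS\<close>\<close>

text \<open>No identity is adjoined here. For an idempotent \<open>e\<close> this loses nothing: as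
  \<open>e = e e e\<close>, membership says that \<open>e\<close> lies in the ideal generated by
  \<open>s\<close>.\<close>

definition sandwich :: "'a sgrp \<Rightarrow> 'a \<Rightarrow> 'a set" where
  "sandwich S s = {a \<cdot>\<^bsub>S\<^esub> s \<cdot>\<^bsub>S\<^esub> b | a b. a \<in> carrier S \<and> b \<in> carrier S}"

definition idem_factor_closed :: "'a sgrp \<Rightarrow> bool" where
  "idem_factor_closed S \<longleftrightarrow>
    (\<forall>e\<in>carrier S. \<forall>s\<in>carrier S. \<forall>t\<in>carrier S. e \<cdot>\<^bsub>S\<^esub> e = e \<longrightarrow>
      e \<in> sandwich S s \<longrightarrow> e \<in> sandwich S t \<longrightarrow> e \<in> sandwich S (s \<cdot>\<^bsub>S\<^esub> t))"

context semigrp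
begin

lemma sandwichI: "\<lbrakk>a \<in> carrier S; b \<in> carrier S; e = a \<cdot> s \<cdot> b\<rbrakk> \<Longrightarrow> e \<in> sandwich S s"
  by (auto simp: sandwich_def)

lemma sandwichE:
  assumes "e \<in> sandwich S s"
  obtains a b where "a \<in> carrier S" "b \<in> carrier S" "e = a \<cdot> s \<cdot> b"
  using assms by (auto simp: sandwich_def)

section \<open>Principal one-sided ideals and Green's relations\<close>

lemma lideal_mono:
  assumes "a \<in> lideal S b" "b \<in> carrier S"
  shows "lideal S a \<subseteq> lideal S b"
proof
  fix x assume "x \<in> lideal S a"
  with assms show "x \<in> lideal S b"
    unfolding lideal_def by (auto simp: closed assoc[symmetric])
qed

lemma rideal_mono:
  assumes "a \<in> rideal S b" "b \<in> carrier S"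
  shows "rideal S a \<subseteq> rideal S b"
proof
  fix x assume "x \<in> rideal S a"
  with assms show "x \<in> rideal S b"
    unfolding rideal_def by (auto simp: closed assoc)
qed

lemma green_LI:
  assumes "a \<in> carrier S" "b \<in> carrier S" "a \<in> lideal S b" "b \<in> lideal S a"
  shows "(a, b) \<in> green_L S"
  using assms lideal_mono[of a b] lideal_mono[of b a] by (auto simp: green_L_def)

lemma green_RI:
  assumes "a \<in> carrier S" "b \<in> carrier S" "a \<in> rideal S b" "b \<in> rideal S a"
  shows "(a, b) \<in> green_R S"
  using assms rideal_mono[of a b] rideal_mono[of b a] by (auto simp: green_R_def)

lemma green_L_D:
  assumes "(a, b) \<in> green_L S"
  shows "a \<in> carrier S" "b \<in> carrier S" "a \<in> lideal S b" "b \<in> lideal S a"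
proof -
  show *: "a \<in> carrier S" "b \<in> carrier S" using assms by (auto simp: green_L_def)
  have "lideal S a = lideal S b" using assms by (auto simp: green_L_def)
  moreover have "a \<in> lideal S a" "b \<in> lideal S b" by (auto simp: lideal_def)
  ultimately show "a \<in> lideal S b" "b \<in> lideal S a" by auto
qed

lemma green_R_D:
  assumes "(a, b) \<in> green_R S"
  shows "a \<in> carrier S" "b \<in> carrier S" "a \<in> rideal S b" "b \<in> rideal S a"
proof -
  show *: "a \<in> carrier S" "b \<in> carrier S" using assms by (auto simp: green_R_def)
  have "rideal S a = rideal S b" using assms by (auto simp: green_R_def)
  moreover have "a \<in> rideal S a" "b \<in> rideal S b" by (auto simp: rideal_def)
  ultimately show "a \<in> rideal S b" "b \<in> rideal S a" by auto
qed

lemma sandwich_lideal: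
  assumes "e \<in> sandwich S s" "s \<in> lideal S t" "t \<in> carrier S"
  shows "e \<in> sandwich S t"
proof -
  obtain a b where ab: "a \<in> carrier S" "b \<in> carrier S" "e = a \<cdot> s \<cdot> b"
    using assms(1) by (rule sandwichE)
  consider "s = t" | c where "c \<in> carrier S" "s = c \<cdot> t"
    using assms(2) by (auto simp: lideal_def)
  then show ?thesis
  proof cases
    case 1 then show ?thesis using assms by simp
  next
    case 2 then show ?thesis using ab assms(3)
      by (intro sandwichI[of "a \<cdot> c" b]) (auto simp: closed assoc)
  qed
qed

lemma sandwich_rideal:
  assumes "e \<in> sandwich S s" "s \<in> rideal S t" "t \<in> carrier S"
  shows "e \<in> sandwich S t"
proof -
  obtain a b where ab: "a \<in> carrier S" "b \<in> carrier S" "e = a \<cdot> s \<cdot> b"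
    using assms(1) by (rule sandwichE)
  consider "s = t" | c where "c \<in> carrier S" "s = t \<cdot> c"
    using assms(2) by (auto simp: rideal_def)
  then show ?thesis
  proof cases
    case 1 then show ?thesis using assms by simp
  next
    case 2 then show ?thesis using ab assms(3)
      by (intro sandwichI[of a "c \<cdot> b"]) (auto simp: closed assoc)
  qed
qed

lemma sandwich_idem:
  assumes "e \<in> carrier S" "e \<cdot> e = e"
  shows "e \<in> sandwich S e"
  using assms by (intro sandwichI[of e e]) auto

text \<open>If \<open>x y = e\<close> and \<open>y e = y\<close>, then \<open>e\<close> is
  \<L>-related to \<open>y\<close> and \<open>y\<close> is \<R>-related to \<open>y x\<close>. Two
  bracketings of \<open>e = a s b\<close> thus place a left multiple and a right multiple of
  \<open>s\<close> in the \<D>-class of \<open>e\<close>.\<close>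

lemma idem_D_factor:
  assumes "a \<in> carrier S" "b \<in> carrier S" "s \<in> carrier S" "e \<in> carrier S"
    and "e \<cdot> e = e" "e = a \<cdot> s \<cdot> b"
  shows "(e, b \<cdot> e \<cdot> a \<cdot> s) \<in> green_D S" "(e, s \<cdot> b \<cdot> e \<cdot> a) \<in> green_D S"
proof -
  have D: "(e, y \<cdot> x) \<in> green_D S"
    if xy: "x \<in> carrier S" "y \<in> carrier S" "x \<cdot> y = e" "y \<cdot> e = y" for x y
  proof -
    have "(e, y) \<in> green_L S"
      using xy assms(4) by (intro green_LI) (force simp: lideal_def)+
    moreover have "y = (y \<cdot> x) \<cdot> y" using xy by (simp add: assoc)
    then have "(y, y \<cdot> x) \<in> green_R S"
      using xy by (intro green_RI) (force simp: rideal_def closed)+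
    ultimately show ?thesis unfolding green_D_def by blast
  qed
  have 1: "(e \<cdot> (a \<cdot> s)) \<cdot> (b \<cdot> e) = e"
  proof -
    have "(e \<cdot> (a \<cdot> s)) \<cdot> (b \<cdot> e) = e \<cdot> (a \<cdot> s \<cdot> b) \<cdot> e" using assms(1-4) by (simp add: assoc closed)
    then show ?thesis using assms by simp
  qed
  have 2: "(e \<cdot> a) \<cdot> (s \<cdot> (b \<cdot> e)) = e" using 1 assms(1-4) by (simp add: assoc closed)
  have ee: "e \<cdot> (e \<cdot> z) = e \<cdot> z" if "z \<in> carrier S" for z
    using that assms by (simp flip: assoc)
  from D[OF _ _ 1] show "(e, b \<cdot> e \<cdot> a \<cdot> s) \<in> green_D S"
    using assms(1-5) by (simp add: assoc closed ee)
  from D[OF _ _ 2] show "(e, s \<cdot> b \<cdot> e \<cdot> a) \<in> green_D S"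
    using assms(1-5) by (simp add: assoc closed ee)
qed

lemma green_D_idem_regular:
  assumes "e \<cdot> e = e" "(e, q) \<in> green_D S"
  shows "regular S q"
proof -
  obtain p where "(e, p) \<in> green_L S" "(p, q) \<in> green_R S"
    using assms(2) by (auto simp: green_D_def)
  note L = green_L_D[OF this(1)] and R = green_R_D[OF this(2)]
  obtain u where u: "u \<in> carrier S" "e = u \<cdot> p"
    using L assms(1) by (auto simp: lideal_def)
  have "p = p \<cdot> e" using L(1,4) assms(1) by (auto simp: lideal_def assoc)
  then have p: "p \<cdot> (u \<cdot> p) = p" using u by simp
  have q: "q = p \<cdot> u \<cdot> q"
  proof -
    consider "q = p" | w where "w \<in> carrier S" "q = p \<cdot> w"
      using R by (auto simp: rideal_def)
    then show ?thesis
    proof cases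
      case 1 then show ?thesis using p u R by (simp add: assoc)
    next
      case 2
      then have "p \<cdot> u \<cdot> q = p \<cdot> (u \<cdot> p) \<cdot> w" using u R by (simp add: assoc closed)
      then show ?thesis using p 2 by simp
    qed
  qed
  consider "p = q" | v where "v \<in> carrier S" "p = q \<cdot> v"
    using R by (auto simp: rideal_def)
  then show ?thesis
  proof cases
    case 1 then show ?thesis using q u R by (auto simp: regular_def)
  next
    case 2
    then have "q = q \<cdot> (v \<cdot> u) \<cdot> q" using q u R by (simp add: assoc closed)
    then show ?thesis using 2 u R by (auto simp: regular_def closed)
  qed
qed

lemma DS_imp_idem_factor_closed:
  assumes "S \<in> DS"
  shows "idem_factor_closed S"
  unfolding idem_factor_closed_def
proof (intro ballI impI)
  fix e s t
  assume e: "e \<in> carrier S" "e \<cdot> e = e" and s: "s \<in> carrier S" and t: "t \<in> carrier S"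
    and es: "e \<in> sandwich S s" and et: "e \<in> sandwich S t"
  obtain a b where ab: "a \<in> carrier S" "b \<in> carrier S" "e = a \<cdot> s \<cdot> b"
    using es by (rule sandwichE)
  obtain c d where cd: "c \<in> carrier S" "d \<in> carrier S" "e = c \<cdot> t \<cdot> d"
    using et by (rule sandwichE)
  let ?D = "green_D S `` {e}"
  \<comment> \<open>\<open>?g\<close> ends in \<open>s\<close> and \<open>?h\<close> begins with
    \<open>t\<close>. Both lie in the \<D>-class of \<open>e\<close>, hence so does their product,
    and a factorisation of \<open>e\<close> through \<open>?g ?h\<close> is one through
    \<open>s t\<close>.\<close>
  let ?g = "b \<cdot> e \<cdot> a \<cdot> s" and ?h = "t \<cdot> d \<cdot> e \<cdot> c"
  have "?D \<in> carrier S // green_D S" using e by (auto simp: quotient_def)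
  moreover have "\<forall>q\<in>?D. regular S q" using green_D_idem_regular e by auto
  ultimately have "subsemigroup ?D S" using assms by (auto simp: DS_def)
  moreover have "?g \<in> ?D" "?h \<in> ?D"
    using idem_D_factor(1)[OF ab(1,2) s e ab(3)] idem_D_factor(2)[OF cd(1,2) t e cd(3)] by auto
  ultimately have "?g \<cdot> ?h \<in> ?D" by (auto simp: subsemigroup_def)
  then obtain p where "(e, p) \<in> green_L S" "(p, ?g \<cdot> ?h) \<in> green_R S"
    by (auto simp: green_D_def)
  note L = green_L_D[OF this(1)] and R = green_R_D[OF this(2)]
  have "e \<in> sandwich S (?g \<cdot> ?h)"
    using sandwich_rideal[OF sandwich_lideal[OF sandwich_idem[OF e] L(3,2)] R(3,2)] .
  then obtain x y where xy: "x \<in> carrier S" "y \<in> carrier S" "e = x \<cdot> (?g \<cdot> ?h) \<cdot> y"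
    by (rule sandwichE)
  have "x \<cdot> (?g \<cdot> ?h) \<cdot> y = (x \<cdot> (b \<cdot> e \<cdot> a)) \<cdot> (s \<cdot> t) \<cdot> ((d \<cdot> e \<cdot> c) \<cdot> y)"
    using xy(1,2) ab(1,2) cd(1,2) e(1) s t by (simp only: closed assoc)
  with xy(3) have "e = (x \<cdot> (b \<cdot> e \<cdot> a)) \<cdot> (s \<cdot> t) \<cdot> ((d \<cdot> e \<cdot> c) \<cdot> y)"
    by (rule trans)
  then show "e \<in> sandwich S (s \<cdot> t)"
    by (rule sandwichI[rotated 2]) (use xy(1,2) ab(1,2) cd(1,2) e(1) in \<open>simp_all only: closed\<close>)
qed

text \<open>Finiteness enters here: in \<open>e S e\<close>, left multiplication by \<open>e z d e\<close> has a
  left inverse, so it is a bijection.\<close>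

lemma idem_right_divides:
  assumes fin: "finite (carrier S)" and DSp: "idem_factor_closed S"
    and e: "e \<in> carrier S" "e \<cdot> e = e" and z: "z \<in> carrier S" "e \<in> sandwich S z"
  obtains t where "t \<in> carrier S" "e = e \<cdot> z \<cdot> t"
proof -
  have "e \<in> sandwich S (e \<cdot> z)"
    using DSp e z sandwich_idem[OF e] unfolding idem_factor_closed_def by blast
  then obtain c d where cd: "c \<in> carrier S" "d \<in> carrier S" "e = c \<cdot> (e \<cdot> z) \<cdot> d"
    by (rule sandwichE)
  let ?M = "{x \<in> carrier S. e \<cdot> x = x \<and> x \<cdot> e = x}"
  let ?n = "e \<cdot> z \<cdot> d \<cdot> e"
  have ee: "e \<cdot> (e \<cdot> x) = e \<cdot> x" if "x \<in> carrier S" for x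
    using that e by (simp flip: assoc)
  have "c \<cdot> ?n \<cdot> x = x" if "x \<in> ?M" for x
  proof -
    have "c \<cdot> ?n \<cdot> x = (c \<cdot> (e \<cdot> z) \<cdot> d) \<cdot> (e \<cdot> x)"
      using that cd(1,2) e z(1) by (simp add: closed assoc)
    also have "\<dots> = e \<cdot> (e \<cdot> x)" by (simp only: cd(3)[symmetric])
    finally show ?thesis using that by simp
  qed
  then have "c \<cdot> (?n \<cdot> x) = x" if "x \<in> ?M" for x
    using that cd(1,2) e(1) z(1) by (simp add: closed assoc)
  then have "inj_on (\<lambda>x. ?n \<cdot> x) ?M" by (rule inj_on_inverseI)
  moreover have "(\<lambda>x. ?n \<cdot> x) ` ?M \<subseteq> ?M"
    using cd(1,2) e z(1) ee by (auto simp: closed assoc)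
  ultimately have "(\<lambda>x. ?n \<cdot> x) ` ?M = ?M"
    using fin by (intro endo_inj_surj) auto
  moreover have "e \<in> ?M" using e by simp
  ultimately obtain x where x: "x \<in> ?M" "e = ?n \<cdot> x" by blast
  have "?n \<cdot> x = e \<cdot> z \<cdot> (d \<cdot> e \<cdot> x)"
    using x(1) cd(1,2) e(1) z(1) by (simp add: closed assoc)
  with x(2) have "e = e \<cdot> z \<cdot> (d \<cdot> e \<cdot> x)" by (rule trans)
  then show ?thesis using x(1) cd(1,2) e(1) closed by (intro that) auto
qed

text \<open>For \<open>a\<close>, \<open>b\<close> in a regular \<D>-class take the idempotent
  \<open>e = t a\<close> with \<open>a e = a\<close>. It lies in the ideal of \<open>b\<close>, so
  \<open>e = e b z\<close> by \<open>idem_right_divides\<close>, whence \<open>a = a b z\<close>.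
  Thus \<open>a b\<close> is \<R>-related to \<open>a\<close> and stays in the class.\<close>

lemma DS_I:
  assumes fin: "finite (carrier S)" and DSp: "idem_factor_closed S"
  shows "S \<in> DS"
proof -
  have "subsemigroup D S"
    if D: "D \<in> carrier S // green_D S" and reg: "\<forall>s\<in>D. regular S s" for D
  proof -
    obtain x where x: "x \<in> carrier S" "D = green_D S `` {x}" using D by (auto elim: quotientE)
    have "a \<cdot> b \<in> D" if a: "a \<in> D" and b: "b \<in> D" for a b
    proof -
      obtain p where "(x, p) \<in> green_L S" and pa: "(p, a) \<in> green_R S"
        using a x by (auto simp: green_D_def)
      note L = green_L_D[OF this(1)] and R = green_R_D[OF this(2)]
      obtain q where "(x, q) \<in> green_L S" "(q, b) \<in> green_R S"
        using b x by (auto simp: green_D_def)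
      note L' = green_L_D[OF this(1)] and R' = green_R_D[OF this(2)]
      obtain t where t: "t \<in> carrier S" "a = a \<cdot> t \<cdot> a"
        using reg a by (auto simp: regular_def)
      let ?e = "t \<cdot> a"
      have ae: "a \<cdot> (t \<cdot> a) = a" using t R by (simp add: assoc)
      have e: "?e \<in> carrier S" "?e \<cdot> ?e = ?e"
        using t R ae by (simp_all add: closed assoc)
      have "?e \<in> sandwich S a"
        using t R e(2) by (intro sandwichI[of t ?e]) (simp_all add: closed)
      then have "?e \<in> sandwich S b"
        using sandwich_rideal sandwich_lideal L L' R R' by metis
      then obtain z where z: "z \<in> carrier S" "?e = ?e \<cdot> b \<cdot> z"
        using idem_right_divides[OF fin DSp e R'(2)] by metis
      have "a = a \<cdot> (?e \<cdot> b \<cdot> z)" using ae z by simp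
      also have "\<dots> = a \<cdot> ?e \<cdot> b \<cdot> z"
        using z(1) e(1) R(2) R'(2) by (simp only: closed assoc)
      finally have "a = a \<cdot> b \<cdot> z" by (simp only: ae)
      then have "(a, a \<cdot> b) \<in> green_R S"
        using z R R' by (intro green_RI) (force simp: rideal_def closed)+
      with pa have "(p, a \<cdot> b) \<in> green_R S" by (auto simp: green_R_def)
      with \<open>(x, p) \<in> green_L S\<close> show ?thesis using x by (auto simp: green_D_def)
    qed
    moreover have "D \<subseteq> carrier S" using x by (auto simp: green_D_def green_R_def)
    ultimately show ?thesis by (auto simp: subsemigroup_def)
  qed
  then show ?thesis using fin semigrp_axioms by (auto simp: DS_def)
qed

text \<open>A nonempty subsemigroup of least cardinality is a singleton.\<close>

lemma ex_idempotent:
  assumes fin: "finite (carrier S)" and Q: "subsemigroup Q S" "Q \<noteq> {}"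
  obtains e where "e \<in> Q" "e \<cdot> e = e"
proof -
  let ?P = "\<lambda>M. M \<subseteq> Q \<and> M \<noteq> {} \<and> subsemigroup M S"
  have "?P Q" using Q by simp
  then obtain M where M: "?P M" and min: "\<And>M'. ?P M' \<Longrightarrow> card M \<le> card M'"
    using exists_least_iff[of "\<lambda>n. \<exists>M. ?P M \<and> card M = n"] by (metis not_less)
  have finM: "finite M" using M fin finite_subset unfolding subsemigroup_def by blast
  have least: "M' = M" if "M' \<subseteq> M" "M' \<noteq> {}" "subsemigroup M' S" for M'
    using that M min[of M'] finM by (meson card_subset_eq card_mono order_antisym order_trans)
  obtain x where x: "x \<in> M" using M by auto
  have cM: "\<And>y. y \<in> M \<Longrightarrow> y \<in> carrier S" and mM: "\<And>y z. y \<in> M \<Longrightarrow> z \<in> M \<Longrightarrow> y \<cdot> z \<in> M"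
    using M by (auto simp: subsemigroup_def)
  \<comment> \<open>Both \<open>x M\<close> and \<open>{y \<in> M. x y = x}\<close> are nonempty
    subsemigroups inside \<open>M\<close>, so minimality makes each equal to \<open>M\<close>; the
    second then contains \<open>x\<close>.\<close>
  have "(\<lambda>y. x \<cdot> y) ` M = M"
  proof (rule least)
    show "subsemigroup ((\<cdot>) x ` M) S"
      unfolding subsemigroup_def
    proof (intro conjI ballI)
      fix y z assume "y \<in> (\<cdot>) x ` M" "z \<in> (\<cdot>) x ` M"
      then obtain y' z' where "y' \<in> M" "z' \<in> M" "y = x \<cdot> y'" "z = x \<cdot> z'" by auto
      then have "y \<cdot> z = x \<cdot> (y' \<cdot> (x \<cdot> z'))" "y' \<cdot> (x \<cdot> z') \<in> M"
        using x cM mM by (simp_all add: assoc closed)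
      then show "y \<cdot> z \<in> (\<cdot>) x ` M" by auto
    qed (use x cM mM closed in auto)
  qed (use x mM in auto)
  then obtain y where y: "y \<in> M" "x \<cdot> y = x" using x by (metis imageE)
  have "{y \<in> M. x \<cdot> y = x} = M"
  proof (rule least)
    show "subsemigroup {y \<in> M. x \<cdot> y = x} S"
      unfolding subsemigroup_def using x cM mM by (auto simp flip: assoc)
  qed (use y in auto)
  then show ?thesis using that[of x] x M by auto
qed

end

section \<open>Lifting membership in \<open>DS\<close>, and separating pairs of
  homomorphisms\<close>

lemma DS_D:
  assumes "S \<in> DS"
  shows "semigrp S" "finite (carrier S)" "idem_factor_closed S"
  using assms semigrp.DS_imp_idem_factor_closed by (auto simp: DS_def)

text \<open>A factorisation of \<open>\<pi> e\<close> through \<open>\<pi> s\<close> and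
  \<open>\<pi> t\<close> lifts to some \<open>m\<close> with \<open>\<pi> m = \<pi> e\<close>,
  though \<open>m\<close> need not be \<open>e\<close>. The fibre condition, applied to
  \<open>e m e\<close>, leads back to \<open>e\<close>, which therefore lies in
  \<open>T s t T\<close>.\<close>

lemma DS_cover:
  assumes T: "semigrp T" "finite (carrier T)" and S: "semigrp S" "idem_factor_closed S"
    and \<pi>: "\<pi> ` carrier T = carrier S"
    and hom: "\<And>x y. \<lbrakk>x \<in> carrier T; y \<in> carrier T\<rbrakk> \<Longrightarrow> \<pi> (x \<cdot>\<^bsub>T\<^esub> y) = \<pi> x \<cdot>\<^bsub>S\<^esub> \<pi> y"
    and fibre: "\<And>e x. \<lbrakk>e \<in> carrier T; x \<in> carrier T; e \<cdot>\<^bsub>T\<^esub> e = e; e \<cdot>\<^bsub>T\<^esub> x = x; x \<cdot>\<^bsub>T\<^esub> e = x; \<pi> x = \<pi> e\<rbrakk>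
      \<Longrightarrow> \<exists>y\<in>carrier T. x \<cdot>\<^bsub>T\<^esub> y = e"
  shows "T \<in> DS"
proof (rule semigrp.DS_I[OF T])
  interpret T: semigrp T by (rule T)
  interpret S: semigrp S by (rule S)
  note [simp] = T.closed hom
  have \<pi>c[simp]: "\<pi> x \<in> carrier S" if "x \<in> carrier T" for x using that \<pi> by auto
  have proj: "\<pi> e \<in> sandwich S (\<pi> s)" if "e \<in> sandwich T s" "s \<in> carrier T" for e s
    using that by (auto elim!: T.sandwichE intro!: S.sandwichI[OF _ _ refl])
  show "idem_factor_closed T"
    unfolding idem_factor_closed_def
  proof (intro ballI impI)
    fix e s t
    assume e: "e \<in> carrier T" "e \<cdot>\<^bsub>T\<^esub> e = e" and s: "s \<in> carrier T" and t: "t \<in> carrier T"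
      and es: "e \<in> sandwich T s" and et: "e \<in> sandwich T t"
    have ee: "\<pi> e \<cdot>\<^bsub>S\<^esub> \<pi> e = \<pi> e" using e hom by metis
    then have "\<pi> e \<in> sandwich S (\<pi> s \<cdot>\<^bsub>S\<^esub> \<pi> t)"
      using S(2) proj[OF es s] proj[OF et t] e s t unfolding idem_factor_closed_def by simp
    then obtain c d where "c \<in> carrier S" "d \<in> carrier S"
      "\<pi> e = c \<cdot>\<^bsub>S\<^esub> (\<pi> s \<cdot>\<^bsub>S\<^esub> \<pi> t) \<cdot>\<^bsub>S\<^esub> d" by (rule S.sandwichE)
    then obtain c d where cd: "c \<in> carrier T" "d \<in> carrier T"
      "\<pi> e = \<pi> c \<cdot>\<^bsub>S\<^esub> (\<pi> s \<cdot>\<^bsub>S\<^esub> \<pi> t) \<cdot>\<^bsub>S\<^esub> \<pi> d" using \<pi> by (metis imageE)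
    define m where "m = c \<cdot>\<^bsub>T\<^esub> (s \<cdot>\<^bsub>T\<^esub> t) \<cdot>\<^bsub>T\<^esub> d"
    have m: "m \<in> carrier T" "\<pi> m = \<pi> e" using cd s t by (simp_all add: m_def)
    let ?x = "e \<cdot>\<^bsub>T\<^esub> m \<cdot>\<^bsub>T\<^esub> e"
    have eex: "e \<cdot>\<^bsub>T\<^esub> (e \<cdot>\<^bsub>T\<^esub> z) = e \<cdot>\<^bsub>T\<^esub> z" if "z \<in> carrier T" for z
      using that e by (simp flip: T.assoc)
    have "\<exists>y\<in>carrier T. ?x \<cdot>\<^bsub>T\<^esub> y = e"
      using e m ee eex by (intro fibre) (simp_all add: T.assoc)
    then obtain y where y: "y \<in> carrier T" "?x \<cdot>\<^bsub>T\<^esub> y = e" by auto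
    show "e \<in> sandwich T (s \<cdot>\<^bsub>T\<^esub> t)"
      using y cd(1,2) e s t
      by (intro T.sandwichI[of "e \<cdot>\<^bsub>T\<^esub> c" "d \<cdot>\<^bsub>T\<^esub> (e \<cdot>\<^bsub>T\<^esub> y)"]) (simp_all add: m_def T.assoc)
  qed
qed

definition separated :: "'a sgrp \<Rightarrow> 'a set \<Rightarrow> bool" where
  "separated S U \<longleftrightarrow> (\<exists>R \<in> (DS :: nat sgrp set). \<exists>\<beta> \<in> sgrp_hom S R. \<exists>\<gamma> \<in> sgrp_hom S R.
       \<beta> \<noteq> \<gamma> \<and> (\<forall>x\<in>U. \<beta> x = \<gamma> x))"

text \<open>Targets over other types are enough: the finite carrier is numbered by
  \<open>to_nat_on\<close>, and the copy of \<open>T\<close> on these numbers is in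
  \<open>DS\<close> because the decoding \<open>k\<close> is a homomorphism with one-point
  fibres.\<close>

lemma separatedI:
  fixes T :: "'b sgrp"
  assumes T: "T \<in> DS"
    and f: "\<And>x. x \<in> carrier S \<Longrightarrow> f x \<in> carrier T"
      "\<And>x y. \<lbrakk>x \<in> carrier S; y \<in> carrier S\<rbrakk> \<Longrightarrow> f (x \<cdot>\<^bsub>S\<^esub> y) = f x \<cdot>\<^bsub>T\<^esub> f y"
    and g: "\<And>x. x \<in> carrier S \<Longrightarrow> g x \<in> carrier T"
      "\<And>x y. \<lbrakk>x \<in> carrier S; y \<in> carrier S\<rbrakk> \<Longrightarrow> g (x \<cdot>\<^bsub>S\<^esub> y) = g x \<cdot>\<^bsub>T\<^esub> g y"
    and S: "semigrp S"
    and z: "z \<in> carrier S" "f z \<noteq> g z"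
    and agree: "\<And>x. x \<in> U \<Longrightarrow> f x = g x"
  shows "separated S U"
proof -
  note T' = DS_D[OF T]
  interpret T: semigrp T by (rule T')
  define h where "h = to_nat_on (carrier T)"
  define k where "k = the_inv_into (carrier T) h"
  have inj: "inj_on h (carrier T)"
    unfolding h_def using T'(2) by (intro inj_on_to_nat_on countable_finite)
  have kh[simp]: "k (h x) = x" if "x \<in> carrier T" for x
    using that inj by (simp add: k_def the_inv_into_f_f)
  define R where "R = \<lparr>carrier = h ` carrier T, mul = \<lambda>x y. h (k x \<cdot>\<^bsub>T\<^esub> k y)\<rparr>"
  have R: "carrier R = h ` carrier T" "x \<cdot>\<^bsub>R\<^esub> y = h (k x \<cdot>\<^bsub>T\<^esub> k y)" for x y
    by (simp_all add: R_def)
  have sR: "semigrp R"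
    by standard (auto simp: R T.closed T.assoc)
  have RDS: "R \<in> DS"
  proof (rule DS_cover[OF sR _ T'(1,3), of k])
    show "\<exists>y\<in>carrier R. x \<cdot>\<^bsub>R\<^esub> y = e"
      if "e \<in> carrier R" "x \<in> carrier R" "e \<cdot>\<^bsub>R\<^esub> e = e" "k x = k e" for e x
    proof -
      have "x = e" using that by (auto simp: R)
      then show ?thesis using that by auto
    qed
  qed (use T' in \<open>auto simp: R T.closed image_image\<close>)
  have hom: "(\<lambda>x\<in>carrier S. h (f' x)) \<in> sgrp_hom S R"
    if "\<And>x. x \<in> carrier S \<Longrightarrow> f' x \<in> carrier T"
      "\<And>x y. \<lbrakk>x \<in> carrier S; y \<in> carrier S\<rbrakk> \<Longrightarrow> f' (x \<cdot>\<^bsub>S\<^esub> y) = f' x \<cdot>\<^bsub>T\<^esub> f' y" for f'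
    using that S by (auto simp: sgrp_hom_def R semigrp.closed)
  have "h (f z) \<noteq> h (g z)" using z f g inj by (auto dest: inj_onD)
  then have "(\<lambda>x\<in>carrier S. h (f x)) \<noteq> (\<lambda>x\<in>carrier S. h (g x))"
    using z by (metis restrict_apply')
  moreover have "\<forall>x\<in>U. (\<lambda>x\<in>carrier S. h (f x)) x = (\<lambda>x\<in>carrier S. h (g x)) x"
    using agree by (simp add: restrict_def)
  ultimately show ?thesis
    unfolding separated_def using RDS hom[OF f] hom[OF g] by blast
qed


section \<open>Duality and gluing along a subsemigroup\<close>

definition opp :: "'a sgrp \<Rightarrow> 'a sgrp" where
  "opp S = \<lparr>carrier = carrier S, mul = \<lambda>x y. y \<cdot>\<^bsub>S\<^esub> x\<rparr>"

lemma opp_simps [simp]: "carrier (opp S) = carrier S" "x \<cdot>\<^bsub>opp S\<^esub> y = y \<cdot>\<^bsub>S\<^esub> x"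
  by (simp_all add: opp_def)

lemma subsemigroup_opp [simp]: "subsemigroup U (opp S) \<longleftrightarrow> subsemigroup U S"
  by (auto simp: subsemigroup_def)

context semigrp
begin

lemma semigrp_opp: "semigrp (opp S)"
  by standard (simp_all add: closed assoc)

lemma sandwich_opp: "s \<in> carrier S \<Longrightarrow> sandwich (opp S) s = sandwich S s"
  unfolding sandwich_def opp_simps by (metis (no_types, lifting) assoc)

lemma idem_factor_closed_opp: "idem_factor_closed S \<Longrightarrow> idem_factor_closed (opp S)"
  unfolding idem_factor_closed_def by (simp add: sandwich_opp closed)

lemma sandwich_trans:
  assumes "e \<in> sandwich S s" "s \<in> sandwich S t" "t \<in> carrier S"
  shows "e \<in> sandwich S t"
proof -
  obtain a b where ab: "a \<in> carrier S" "b \<in> carrier S" "e = a \<cdot> s \<cdot> b"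
    using assms(1) by (rule sandwichE)
  obtain c d where cd: "c \<in> carrier S" "d \<in> carrier S" "s = c \<cdot> t \<cdot> d"
    using assms(2) by (rule sandwichE)
  show ?thesis
    using ab cd assms(3) by (intro sandwichI[of "a \<cdot> c" "d \<cdot> b"]) (simp_all add: closed assoc)
qed

lemma sandwich_factors:
  assumes "e \<in> sandwich S (s \<cdot> t)" "s \<in> carrier S" "t \<in> carrier S"
  shows "e \<in> sandwich S s" "e \<in> sandwich S t"
proof -
  obtain a b where ab: "a \<in> carrier S" "b \<in> carrier S" "e = a \<cdot> (s \<cdot> t) \<cdot> b"
    using assms(1) by (rule sandwichE)
  show "e \<in> sandwich S s"
    using ab assms by (intro sandwichI[of a "t \<cdot> b"]) (simp_all add: closed assoc)
  show "e \<in> sandwich S t"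
    using ab assms by (intro sandwichI[of "a \<cdot> s" b]) (simp_all add: closed assoc)
qed

lemma separated_opp:
  assumes "separated (opp S) U"
  shows "separated S U"
proof -
  obtain R :: "nat sgrp" and \<beta> \<gamma> where R: "R \<in> DS"
    and \<beta>: "\<beta> \<in> sgrp_hom (opp S) R" and \<gamma>: "\<gamma> \<in> sgrp_hom (opp S) R"
    and ne: "\<beta> \<noteq> \<gamma>" and agree: "\<forall>x\<in>U. \<beta> x = \<gamma> x"
    using assms by (auto simp: separated_def)
  note R' = DS_D[OF R]
  have "opp R \<in> DS"
    using R' by (intro semigrp.DS_I)
      (auto intro: semigrp.semigrp_opp semigrp.idem_factor_closed_opp)
  moreover have "\<beta> \<in> sgrp_hom S (opp R)" "\<gamma> \<in> sgrp_hom S (opp R)"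
    using \<beta> \<gamma> by (auto simp: sgrp_hom_def)
  ultimately show ?thesis using ne agree unfolding separated_def by blast
qed

end

text \<open>This is what associativity of the glued product requires. If \<open>b c \<in> U\<close>
  and \<open>a b c \<notin> U\<close>, then \<open>a (b c)\<close> goes to the copy of
  \<open>a\<close>, while \<open>(a b) c\<close> follows \<open>b\<close> or \<open>c\<close> when
  one of them is outside \<open>U\<close>.\<close>

definition right_liftable :: "'a sgrp \<Rightarrow> 'a set \<Rightarrow> bool" where
  "right_liftable S U \<longleftrightarrow> (\<forall>a\<in>carrier S. \<forall>b\<in>carrier S. \<forall>c\<in>carrier S.
      a \<cdot>\<^bsub>S\<^esub> b \<cdot>\<^bsub>S\<^esub> c \<notin> U \<longrightarrow> b \<cdot>\<^bsub>S\<^esub> c \<in> U \<longrightarrow> b \<in> U \<and> c \<in> U)"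

lemma (in semigrp) separated_right_liftable:
  assumes fin: "finite (carrier S)" and ifc: "idem_factor_closed S"
    and U: "subsemigroup U S" "U \<noteq> carrier S" and lift: "right_liftable S U"
  shows "separated S U"
proof -
  have UU: "x \<cdot> y \<in> U" if "x \<in> U" "y \<in> U" for x y using U that by (auto simp: subsemigroup_def)
  have UC: "x \<in> carrier S" if "x \<in> U" for x using U that by (auto simp: subsemigroup_def)
  have lift': "b \<in> U \<and> c \<in> U"
    if "a \<in> carrier S" "b \<in> carrier S" "c \<in> carrier S" "a \<cdot> (b \<cdot> c) \<notin> U" "b \<cdot> c \<in> U" for a b c
    using lift that by (auto simp: right_liftable_def assoc)
  \<comment> \<open>The Boolean selects one of two copies of \<open>S\<close>; forcing it to
    \<open>False\<close> on \<open>U\<close> identifies the copies there.\<close>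
  define T where "T = \<lparr>carrier = {(s, i). s \<in> carrier S \<and> (s \<in> U \<longrightarrow> \<not> i)},
    mul = \<lambda>(s, i) (t, j). (s \<cdot> t, s \<cdot> t \<notin> U \<and> (if t \<in> U then i else j))\<rparr>"
  have T: "carrier T = {(s, i). s \<in> carrier S \<and> (s \<in> U \<longrightarrow> \<not> i)}"
    "(s, i) \<cdot>\<^bsub>T\<^esub> (t, j) = (s \<cdot> t, s \<cdot> t \<notin> U \<and> (if t \<in> U then i else j))" for s i t j
    by (simp_all add: T_def)
  have sT: "semigrp T"
  proof
    fix x y z assume "x \<in> carrier T" "y \<in> carrier T" "z \<in> carrier T"
    then obtain a i b j c k where
      *: "x = (a, i)" "y = (b, j)" "z = (c, k)" "a \<in> carrier S" "b \<in> carrier S" "c \<in> carrier S"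
        "a \<in> U \<longrightarrow> \<not> i" "b \<in> U \<longrightarrow> \<not> j" "c \<in> U \<longrightarrow> \<not> k"
      by (auto simp: T)
    have "a \<cdot> (b \<cdot> c) \<in> U" if "a \<cdot> b \<in> U" "c \<in> U"
      using that UU[of "a \<cdot> b" c] * by (simp add: assoc)
    then show "x \<cdot>\<^bsub>T\<^esub> y \<cdot>\<^bsub>T\<^esub> z = x \<cdot>\<^bsub>T\<^esub> (y \<cdot>\<^bsub>T\<^esub> z)"
      using lift'[of a b c] UU[of b c] * by (auto simp: T assoc)
  qed (auto simp: T closed)
  have finT: "finite (carrier T)"
    by (rule finite_subset[of _ "carrier S \<times> UNIV"]) (auto simp: T fin)
  have TDS: "T \<in> DS"
  proof (rule DS_cover[OF sT finT semigrp_axioms ifc, of fst])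
    show "fst ` carrier T = carrier S" by (force simp: T)
    show "\<exists>y\<in>carrier T. x \<cdot>\<^bsub>T\<^esub> y = e"
      if e: "e \<in> carrier T" "e \<cdot>\<^bsub>T\<^esub> e = e" "x \<in> carrier T" "x \<cdot>\<^bsub>T\<^esub> e = x" "fst x = fst e" for e x
    proof -
      \<comment> \<open>Outside \<open>U\<close> the product \<open>x e\<close> takes the copy of
        its right factor, so \<open>x = x e = e\<close>; over \<open>U\<close> each fibre has one
        element.\<close>
      have "x = e" using that by (cases x; cases e) (auto simp: T split: if_splits)
      then show ?thesis using e by auto
    qed
  qed (auto simp: T)
  obtain n where n: "n \<in> carrier S" "n \<notin> U" using U by (auto simp: subsemigroup_def)
  show ?thesis
  proof (rule separatedI[OF TDS, of S "\<lambda>s. (s, False)" "\<lambda>s. (s, s \<notin> U)" n])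
    show "(x \<cdot> y, x \<cdot> y \<notin> U) = (x, x \<notin> U) \<cdot>\<^bsub>T\<^esub> (y, y \<notin> U)" for x y
      using UU[of x y] by (auto simp: T)
  qed (use n semigrp_axioms in \<open>auto simp: T closed\<close>)
qed

section \<open>Maximal submonoids\<close>

text \<open>In a monoid these are the elements \<J>-above some element of the complement. For
  maximal \<open>U\<close> any one element of the complement can serve as \<open>n\<close>.\<close>

definition above_compl :: "'a sgrp \<Rightarrow> 'a set \<Rightarrow> 'a set" where
  "above_compl S U = {s \<in> carrier S. \<exists>n\<in>carrier S - U. n \<in> sandwich S s}"

text \<open>For a maximal submonoid \<open>U\<close> this is a single \<J>-class. It contains
  \<open>S - U\<close> and may also meet \<open>U\<close>.\<close>

definition level_compl :: "'a sgrp \<Rightarrow> 'a set \<Rightarrow> 'a set" where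
  "level_compl S U = {s \<in> carrier S. \<exists>n\<in>carrier S - U. n \<in> sandwich S s \<and> s \<in> sandwich S n}"

locale maximal_submonoid = semigrp +
  fixes idn and U
  assumes fin: "finite (carrier S)" and ifc: "idem_factor_closed S"
    and idn: "idn \<in> U" "\<And>x. x \<in> carrier S \<Longrightarrow> idn \<cdot> x = x" "\<And>x. x \<in> carrier S \<Longrightarrow> x \<cdot> idn = x"
    and sub: "subsemigroup U S" and proper: "U \<noteq> carrier S"
    and maximal: "\<And>V. \<lbrakk>subsemigroup V S; U \<subseteq> V\<rbrakk> \<Longrightarrow> V = U \<or> V = carrier S"
begin

abbreviation "F \<equiv> above_compl S U"
abbreviation "J \<equiv> level_compl S U"

lemma UC: "x \<in> U \<Longrightarrow> x \<in> carrier S"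
  using sub by (auto simp: subsemigroup_def)

lemma UU: "\<lbrakk>x \<in> U; y \<in> U\<rbrakk> \<Longrightarrow> x \<cdot> y \<in> U"
  using sub by (auto simp: subsemigroup_def)

lemma idnC: "idn \<in> carrier S"
  using idn UC by auto

lemma sandwich_self: "x \<in> carrier S \<Longrightarrow> x \<in> sandwich S x"
  using idn idnC by (intro sandwichI[of idn idn]) auto

lemma ex_compl: obtains n where "n \<in> carrier S" "n \<notin> U"
  using proper UC by auto

lemma maximal_opp: "maximal_submonoid (opp S) idn U"
  by (intro maximal_submonoid.intro semigrp_opp maximal_submonoid_axioms.intro)
    (use fin ifc idn sub proper maximal in \<open>auto simp: idem_factor_closed_opp\<close>)

lemma F_opp: "above_compl (opp S) U = F"
  by (auto simp: above_compl_def sandwich_opp)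

lemma J_opp: "level_compl (opp S) U = J"
  by (auto simp: level_compl_def sandwich_opp)

text \<open>\<open>U \<union> S x S\<close> is a subsemigroup larger than \<open>U\<close>, as it
  contains \<open>x\<close>, so maximality makes it all of \<open>S\<close>.\<close>

lemma compl_equiv:
  assumes x: "x \<in> carrier S" "x \<notin> U" and y: "y \<in> carrier S" "y \<notin> U"
  shows "y \<in> sandwich S x"
proof -
  let ?I = "sandwich S x"
  have IC: "?I \<subseteq> carrier S" using x by (auto simp: sandwich_def closed)
  have Ir: "z \<cdot> w \<in> ?I" if z: "z \<in> ?I" and w: "w \<in> carrier S" for z w
  proof -
    obtain a b where "a \<in> carrier S" "b \<in> carrier S" "z = a \<cdot> x \<cdot> b"
      using z by (rule sandwichE)
    then show ?thesis
      using x w by (intro sandwichI[of a "b \<cdot> w"]) (simp_all add: closed assoc)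
  qed
  have Il: "w \<cdot> z \<in> ?I" if z: "z \<in> ?I" and w: "w \<in> carrier S" for z w
  proof -
    obtain a b where "a \<in> carrier S" "b \<in> carrier S" "z = a \<cdot> x \<cdot> b"
      using z by (rule sandwichE)
    then show ?thesis
      using x w by (intro sandwichI[of "w \<cdot> a" b]) (simp_all add: closed assoc)
  qed
  have "subsemigroup (U \<union> ?I) S"
    unfolding subsemigroup_def using IC UC UU Ir Il by blast
  then have "U \<union> ?I = carrier S"
    using maximal[of "U \<union> ?I"] sandwich_self x by blast
  then show ?thesis using y by blast
qed

lemma F_iff:
  assumes "n \<in> carrier S" "n \<notin> U"
  shows "s \<in> F \<longleftrightarrow> s \<in> carrier S \<and> n \<in> sandwich S s"
proof
  assume "s \<in> F"
  then obtain m where m: "s \<in> carrier S" "m \<in> carrier S" "m \<notin> U" "m \<in> sandwich S s"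
    by (auto simp: above_compl_def)
  then show "s \<in> carrier S \<and> n \<in> sandwich S s"
    using sandwich_trans[OF compl_equiv[OF m(2,3) assms] m(4)] by simp
qed (use assms in \<open>auto simp: above_compl_def\<close>)

lemma J_iff:
  assumes "n \<in> carrier S" "n \<notin> U"
  shows "s \<in> J \<longleftrightarrow> s \<in> carrier S \<and> n \<in> sandwich S s \<and> s \<in> sandwich S n"
proof
  assume "s \<in> J"
  then obtain m where m: "s \<in> carrier S" "m \<in> carrier S" "m \<notin> U" "m \<in> sandwich S s"
      "s \<in> sandwich S m"
    by (auto simp: level_compl_def)
  then show "s \<in> carrier S \<and> n \<in> sandwich S s \<and> s \<in> sandwich S n"
    using sandwich_trans[OF compl_equiv[OF m(2,3) assms] m(4)]
      sandwich_trans[OF m(5) compl_equiv[OF assms m(2,3)]] assms by simp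
qed (use assms in \<open>auto simp: level_compl_def\<close>)

lemma compl_J: "n \<in> carrier S \<Longrightarrow> n \<notin> U \<Longrightarrow> n \<in> J"
  by (simp add: J_iff sandwich_self)

lemma JC: "x \<in> J \<Longrightarrow> x \<in> carrier S" by (simp add: level_compl_def)
lemma FC: "x \<in> F \<Longrightarrow> x \<in> carrier S" by (simp add: above_compl_def)
lemma JF: "x \<in> J \<Longrightarrow> x \<in> F" by (auto simp: level_compl_def above_compl_def)

lemma F_factors:
  assumes "s \<cdot> t \<in> F" "s \<in> carrier S" "t \<in> carrier S"
  shows "s \<in> F" "t \<in> F"
proof -
  obtain n where n: "n \<in> carrier S" "n \<notin> U" by (rule ex_compl)
  show "s \<in> F" "t \<in> F"
    using assms sandwich_factors[of n s t] by (simp_all add: F_iff[OF n])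
qed

lemma J_equiv:
  assumes "x \<in> J" "y \<in> J"
  shows "x \<in> sandwich S y"
proof -
  obtain n where n: "n \<in> carrier S" "n \<notin> U" by (rule ex_compl)
  show ?thesis using assms sandwich_trans[of x n y] by (simp add: J_iff[OF n])
qed

lemma F_iff_J:
  assumes "x \<in> J"
  shows "s \<in> F \<longleftrightarrow> s \<in> carrier S \<and> x \<in> sandwich S s"
proof -
  obtain n where n: "n \<in> carrier S" "n \<notin> U" by (rule ex_compl)
  show ?thesis
    using assms sandwich_trans[of x n s] sandwich_trans[of n x s]
    by (auto simp: J_iff[OF n] F_iff[OF n])
qed

lemma J_I:
  assumes "z \<in> F" "z \<in> sandwich S x" "x \<in> J"
  shows "z \<in> J"
proof -
  obtain n where n: "n \<in> carrier S" "n \<notin> U" by (rule ex_compl)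
  show ?thesis
    using assms sandwich_trans[of z x n] n by (simp add: J_iff[OF n] F_iff[OF n])
qed

section \<open>Products and divisibility when \<open>J\<close> contains an idempotent\<close>

context
  fixes i assumes i: "i \<in> J" "i \<cdot> i = i"
begin

text \<open>\<open>F\<close> consists of the elements whose ideal contains the idempotent
  \<open>i\<close>, a set closed under products by \<open>idem_factor_closed\<close>.\<close>

lemma F_mult:
  assumes "s \<in> F" "t \<in> F"
  shows "s \<cdot> t \<in> F"
proof -
  have "s \<in> carrier S" "t \<in> carrier S" "i \<in> sandwich S s" "i \<in> sandwich S t"
    using assms by (simp_all add: F_iff_J[OF i(1)])
  moreover from this have "i \<in> sandwich S (s \<cdot> t)"
    using ifc i JC[OF i(1)] by (simp add: idem_factor_closed_def)
  ultimately show ?thesis by (simp add: F_iff_J[OF i(1)] closed)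
qed

lemma J_mult_right:
  assumes "a \<in> J" "z \<in> F"
  shows "a \<cdot> z \<in> J"
proof (rule J_I[OF F_mult[OF JF[OF assms(1)] assms(2)] _ assms(1)])
  show "a \<cdot> z \<in> sandwich S a"
    using JC[OF assms(1)] FC[OF assms(2)] idn(2) idnC by (intro sandwichI[of idn z]) simp_all
qed

text \<open>Write \<open>a = p i q\<close>. Then \<open>q z \<in> F\<close>, so the idempotent
  satisfies \<open>i = i q z t\<close>, and inserting this gives \<open>a = a z t q\<close>.\<close>

lemma J_right_divides:
  assumes a: "a \<in> J" and z: "z \<in> F"
  obtains t where "t \<in> carrier S" "a = a \<cdot> z \<cdot> t"
proof -
  note C = JC[OF i(1)] JC[OF a] FC[OF z]
  obtain p q where pq: "p \<in> carrier S" "q \<in> carrier S" "a = p \<cdot> i \<cdot> q"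
    using J_equiv[OF a i(1)] by (rule sandwichE)
  have "p \<cdot> i \<cdot> q \<in> F" using JF[OF a] by (simp only: pq(3))
  then have "q \<in> F" by (rule F_factors(2)) (use pq(1,2) C in \<open>simp_all add: closed\<close>)
  then have "i \<in> sandwich S (q \<cdot> z)" using F_mult[of q z] z by (simp add: F_iff_J[OF i(1)])
  then obtain t where t: "t \<in> carrier S" "i = i \<cdot> (q \<cdot> z) \<cdot> t"
    using idem_right_divides[OF fin ifc C(1) i(2) closed[OF pq(2) C(3)]] by metis
  have "a \<cdot> z \<cdot> (t \<cdot> q) = p \<cdot> (i \<cdot> (q \<cdot> z) \<cdot> t) \<cdot> q"
    unfolding pq(3) using pq(1,2) t(1) C by (simp add: closed assoc)
  also have "\<dots> = a" by (simp only: t(2)[symmetric] pq(3))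
  finally show ?thesis using that[of "t \<cdot> q"] t(1) pq(2) closed by simp
qed

text \<open>Pigeonhole: \<open>t \<mapsto> t u y\<close> is injective on \<open>S y\<close> and maps \<open>(S y \<inter> U) \<union> {x}\<close> into
  \<open>S y \<inter> U\<close>.\<close>

lemma right_cancel_sub:
  assumes x: "x = s \<cdot> y" "s \<in> carrier S" and y: "y \<in> J" "y \<in> U"
    and u: "u \<in> F" "u \<in> U" and xu: "x \<cdot> u \<in> U"
  shows "x \<in> U"
proof (rule ccontr)
  assume xU: "x \<notin> U"
  note C = JC[OF y(1)] FC[OF u(1)]
  \<comment> \<open>Since \<open>u y \<in> F\<close>, some \<open>r\<close> undoes right
    multiplication by \<open>u y\<close> at \<open>y\<close>, hence on all of
    \<open>S y\<close>.\<close>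
  obtain r where r: "r \<in> carrier S" "y = y \<cdot> (u \<cdot> y) \<cdot> r"
    using J_right_divides[OF y(1) F_mult[OF u(1) JF[OF y(1)]]] .
  let ?Z = "(\<lambda>s. s \<cdot> y) ` carrier S" and ?f = "\<lambda>t. t \<cdot> (u \<cdot> y)"
  have "?f t \<cdot> r = t" if "t \<in> ?Z" for t
  proof -
    obtain s' where s': "s' \<in> carrier S" "t = s' \<cdot> y" using \<open>t \<in> ?Z\<close> by auto
    then have "?f t \<cdot> r = s' \<cdot> (y \<cdot> (u \<cdot> y) \<cdot> r)" using C r(1) by (simp add: closed assoc)
    then show ?thesis using s'(2) by (simp only: r(2)[symmetric])
  qed
  then have inj: "inj_on ?f ?Z" by (rule inj_on_inverseI)
  have fZ: "?f t \<in> ?Z" if "t \<in> ?Z" for t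
  proof -
    have "t \<in> carrier S" using that C closed by auto
    then have "?f t = (t \<cdot> u) \<cdot> y" using C by (simp add: assoc)
    then show ?thesis using \<open>t \<in> carrier S\<close> C closed by blast
  qed
  have xZ: "x \<in> ?Z" using x by auto
  have "?f x = (x \<cdot> u) \<cdot> y" using x C by (simp add: closed assoc)
  then have "?f x \<in> U" using xu y UU by simp
  then have "?f ` insert x (?Z \<inter> U) \<subseteq> ?Z \<inter> U"
    using fZ xZ UU u y by auto
  moreover have "inj_on ?f (insert x (?Z \<inter> U))"
    by (rule inj_on_subset[OF inj]) (use xZ in blast)
  ultimately have "card (insert x (?Z \<inter> U)) \<le> card (?Z \<inter> U)"
    using fin by (intro card_inj_on_le) auto
  then show False using xU fin by simp
qed

end


lemma left_cancel_sub:
  assumes "i \<in> J" "i \<cdot> i = i" "x = y \<cdot> s" "s \<in> carrier S" "y \<in> J" "y \<in> U"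
    and "u \<in> F" "u \<in> U" "u \<cdot> x \<in> U"
  shows "x \<in> U"
  using maximal_submonoid.right_cancel_sub[OF maximal_opp, unfolded J_opp F_opp, of i x s y u] assms
  by auto

text \<open>A failing triple has \<open>b c \<in> J \<inter> U\<close> and \<open>a\<close>,
  \<open>a b c\<close> outside \<open>U\<close>. Then \<open>a = p a (b c q)\<close> for some
  \<open>p\<close>, \<open>q\<close>, and finiteness yields an idempotent in \<open>J\<close>.
  Moreover \<open>U \<union> S (J \<inter> U)\<close> is a submonoid containing
  \<open>a b c\<close>, so by maximality it is \<open>S\<close>.\<close>

lemma not_right_liftableE:
  assumes "\<not> right_liftable S U"
  obtains i where "i \<in> J" "i \<cdot> i = i"
    "\<And>x. x \<in> J \<Longrightarrow> \<exists>y\<in>J \<inter> U. \<exists>s\<in>carrier S. x = s \<cdot> y"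
proof -
  obtain a b c where C: "a \<in> carrier S" "b \<in> carrier S" "c \<in> carrier S"
    and abc: "a \<cdot> b \<cdot> c \<notin> U" and bc: "b \<cdot> c \<in> U" and bcU: "\<not> (b \<in> U \<and> c \<in> U)"
    using assms by (auto simp: right_liftable_def)
  have abc': "a \<cdot> (b \<cdot> c) \<notin> U" using abc C by (simp add: assoc)
  have aU: "a \<notin> U" using abc' bc UU by blast
  obtain n where n: "n \<in> carrier S" "n \<notin> U" "n = b \<or> n = c" using bcU C by blast
  have bcn: "b \<cdot> c \<in> sandwich S n"
    using sandwich_factors[OF sandwich_self, of b c] n(3) C closed by auto
  note aJ = compl_J[OF C(1) aU] and nJ = compl_J[OF n(1,2)]
    and abcJ = compl_J[OF closed[OF C(1) closed[OF C(2,3)]] abc']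
  have "b \<cdot> c \<in> F"
    using F_factors(2)[OF JF[OF abcJ]] C closed by simp
  then have bcJ: "b \<cdot> c \<in> J" using J_I bcn nJ by blast
  obtain p q where pq: "p \<in> carrier S" "q \<in> carrier S" "a = p \<cdot> (a \<cdot> (b \<cdot> c)) \<cdot> q"
    using J_equiv[OF aJ abcJ] by (rule sandwichE)
  \<comment> \<open>The \<open>w\<close> in \<open>S n S\<close> with \<open>a \<in> S a w\<close>.
    An idempotent among them is a factor of \<open>a\<close>, hence in \<open>F\<close>, and being
    in \<open>S n S\<close> it is in \<open>J\<close>.\<close>
  let ?Q = "{w \<in> sandwich S n. w \<in> carrier S \<and> (\<exists>p\<in>carrier S. a = p \<cdot> a \<cdot> w)}"
  have "subsemigroup ?Q S"
    unfolding subsemigroup_def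
  proof (intro conjI ballI)
    fix x y assume "x \<in> ?Q" "y \<in> ?Q"
    then obtain p p' where x: "x \<in> sandwich S n" "x \<in> carrier S" "p \<in> carrier S" "a = p \<cdot> a \<cdot> x"
      and y: "y \<in> carrier S" "p' \<in> carrier S" "a = p' \<cdot> a \<cdot> y"
      by blast
    have "x \<cdot> y \<in> sandwich S x"
      using x(2) y(1) idn idnC by (intro sandwichI[of idn y]) simp_all
    then have "x \<cdot> y \<in> sandwich S n" using x(1) n(1) by (rule sandwich_trans)
    moreover have "p' \<cdot> p \<cdot> a \<cdot> (x \<cdot> y) = p' \<cdot> (p \<cdot> a \<cdot> x) \<cdot> y"
      using x(2,3) y(1,2) C by (simp add: closed assoc)
    then have "p' \<cdot> p \<cdot> a \<cdot> (x \<cdot> y) = a"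
      by (simp only: x(4)[symmetric] y(3)[symmetric])
    then have "\<exists>p\<in>carrier S. a = p \<cdot> a \<cdot> (x \<cdot> y)"
      using closed[OF y(2) x(3)] by metis
    ultimately show "x \<cdot> y \<in> ?Q" using x(2) y(1) closed by blast
  qed blast
  moreover have "b \<cdot> c \<cdot> q \<in> ?Q"
  proof -
    have "b \<cdot> c \<cdot> q \<in> sandwich S (b \<cdot> c)"
      using C pq(2) idn idnC by (intro sandwichI[of idn q]) (simp_all add: closed)
    then have "b \<cdot> c \<cdot> q \<in> sandwich S n" using bcn n(1) by (rule sandwich_trans)
    moreover have "p \<cdot> (a \<cdot> (b \<cdot> c)) \<cdot> q = p \<cdot> a \<cdot> (b \<cdot> c \<cdot> q)"
      using C pq(1,2) by (simp add: closed assoc)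
    with pq(3) have "a = p \<cdot> a \<cdot> (b \<cdot> c \<cdot> q)" by (rule trans)
    moreover have "b \<cdot> c \<cdot> q \<in> carrier S" using C pq(2) by (simp add: closed)
    ultimately show ?thesis using pq(1) by blast
  qed
  ultimately obtain i where i: "i \<in> ?Q" "i \<cdot> i = i"
    using ex_idempotent[OF fin, of ?Q] by blast
  then obtain p' where p': "p' \<in> carrier S" "a = p' \<cdot> a \<cdot> i" "i \<in> carrier S" "i \<in> sandwich S n"
    by blast
  have "p' \<cdot> a \<cdot> i \<in> F" using JF[OF aJ] by (simp only: p'(2)[symmetric])
  then have "i \<in> F" by (rule F_factors(2)) (use p'(1,3) C in \<open>simp_all add: closed\<close>)
  then have iJ: "i \<in> J" using J_I p'(4) nJ by blast
  let ?V = "U \<union> {x \<in> carrier S. \<exists>y\<in>J \<inter> U. \<exists>s\<in>carrier S. x = s \<cdot> y}"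
  have "subsemigroup ?V S"
    unfolding subsemigroup_def
  proof (intro conjI ballI)
    show "?V \<subseteq> carrier S" using UC by auto
    fix x y assume x: "x \<in> ?V" and y: "y \<in> ?V"
    then have xyC: "x \<in> carrier S" "y \<in> carrier S" using UC by auto
    show "x \<cdot> y \<in> ?V"
    proof (cases "x \<cdot> y \<in> U")
      case False
      then have xyJ: "x \<cdot> y \<in> J" using compl_J closed xyC by blast
      show ?thesis
      proof (cases "y \<in> U")
        case True
        then obtain z s where z: "z \<in> J" "z \<in> U" "s \<in> carrier S" "x = s \<cdot> z"
          using x False UU by auto
        \<comment> \<open>\<open>z y\<close> is a factor of \<open>x y\<close>, which is in
          \<open>F\<close>, and it is \<J>-below \<open>z\<close>, so it stays in
          \<open>J\<close>.\<close>
        have eq: "x \<cdot> y = s \<cdot> (z \<cdot> y)" using z xyC JC by (simp add: assoc)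
        then have "z \<cdot> y \<in> F"
          using F_factors(2)[of s "z \<cdot> y"] JF[OF xyJ] z JC xyC closed by simp
        moreover have "z \<cdot> y \<in> sandwich S z"
          using z JC xyC idn idnC by (intro sandwichI[of idn y]) simp_all
        ultimately have "z \<cdot> y \<in> J \<inter> U" using J_I z UU True by blast
        then show ?thesis using eq z closed xyC by blast
      next
        case False
        then obtain z s where z: "z \<in> J" "z \<in> U" "s \<in> carrier S" "y = s \<cdot> z"
          using y by auto
        then have "x \<cdot> y = (x \<cdot> s) \<cdot> z" using xyC JC by (simp add: assoc)
        then show ?thesis using z closed xyC by blast
      qed
    qed simp
  qed
  moreover have "?V \<noteq> U"
  proof
    assume V: "?V = U"
    have "a \<cdot> (b \<cdot> c) \<in> ?V" using bcJ bc C closed by blast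
    with V abc' show False by simp
  qed
  ultimately have V: "?V = carrier S" using maximal[of ?V] by blast
  have "\<exists>y\<in>J \<inter> U. \<exists>s\<in>carrier S. x = s \<cdot> y" if x: "x \<in> J" for x
  proof (cases "x \<in> U")
    case True
    then show ?thesis using x idn(2)[OF JC[OF x]] idnC by (metis IntI)
  next
    case False
    have "x \<in> ?V" using V JC[OF x] by simp
    with False show ?thesis by simp
  qed
  then show ?thesis using that iJ i(2) by blast
qed

text \<open>The maps \<open>s \<mapsto> (s, 0)\<close> and \<open>s \<mapsto> (s, d s)\<close> into a semidirect product of \<open>S\<close> with the
  group of subsets of \<open>J\<close> under symmetric difference, where \<open>d s = s\<^sup>-\<^sup>1 (J \<inter> U) + (J \<inter> U)\<close> is
  an inner derivation. Outside \<open>F\<close> the second component is collapsed to \<open>0\<close>.\<close>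

lemma separated_derivation:
  assumes i: "i \<in> J" "i \<cdot> i = i"
    and cancel: "\<And>x u. \<lbrakk>x \<in> J; u \<in> F; u \<in> U; x \<cdot> u \<in> U\<rbrakk> \<Longrightarrow> x \<in> U"
    and x0: "x0 \<in> J" "x0 \<in> U" and s0: "s0 \<in> F" "x0 \<cdot> s0 \<notin> U"
  shows "separated S U"
proof -
  have FF: "s \<cdot> t \<in> F \<longleftrightarrow> s \<in> F \<and> t \<in> F" if "s \<in> carrier S" "t \<in> carrier S" for s t
    using that F_mult[OF i] F_factors by blast
  note JF_J = J_mult_right[OF i]
  \<comment> \<open>The equivalence with a negated side is exclusive or: for
    \<open>s t \<in> F\<close> the second component is the symmetric difference of \<open>v\<close>
    and the preimage of \<open>w\<close> under right multiplication by \<open>s\<close>.\<close>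
  define T where "T = \<lparr>carrier = {(s, v). s \<in> carrier S \<and> v \<subseteq> J \<and> (s \<notin> F \<longrightarrow> v = {})},
    mul = \<lambda>(s, v) (t, w). (s \<cdot> t, {x \<in> J. s \<cdot> t \<in> F \<and> (x \<in> v \<longleftrightarrow> x \<cdot> s \<notin> w)})\<rparr>"
  have T: "carrier T = {(s, v). s \<in> carrier S \<and> v \<subseteq> J \<and> (s \<notin> F \<longrightarrow> v = {})}"
    "(s, v) \<cdot>\<^bsub>T\<^esub> (t, w) = (s \<cdot> t, {x \<in> J. s \<cdot> t \<in> F \<and> (x \<in> v \<longleftrightarrow> x \<cdot> s \<notin> w)})" for s v t w
    by (simp_all add: T_def)
  have sT: "semigrp T"
  proof
    fix x y z assume "x \<in> carrier T" "y \<in> carrier T" "z \<in> carrier T"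
    moreover obtain a u b v c w where "x = (a, u)" "y = (b, v)" "z = (c, w)"
      by (metis surj_pair)
    ultimately have *: "x = (a, u)" "y = (b, v)" "z = (c, w)"
        "a \<in> carrier S" "b \<in> carrier S" "c \<in> carrier S"
      by (auto simp: T)
    have "j \<cdot> (a \<cdot> b) = j \<cdot> a \<cdot> b" if "j \<in> J" for j
      using * JC[OF that] by (simp add: assoc)
    then show "x \<cdot>\<^bsub>T\<^esub> y \<cdot>\<^bsub>T\<^esub> z = x \<cdot>\<^bsub>T\<^esub> (y \<cdot>\<^bsub>T\<^esub> z)"
      using * by (auto simp: T FF closed JF_J assoc)
  qed (auto simp: T closed)
  have finT: "finite (carrier T)"
    by (rule finite_subset[of _ "carrier S \<times> Pow (carrier S)"]) (auto simp: T fin dest: JC)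
  have TDS: "T \<in> DS"
  proof (rule DS_cover[OF sT finT semigrp_axioms ifc, of fst])
    show "fst ` carrier T = carrier S" by (force simp: T)
    show "\<exists>y\<in>carrier T. x \<cdot>\<^bsub>T\<^esub> y = e"
      if e: "e \<in> carrier T" "x \<in> carrier T" "e \<cdot>\<^bsub>T\<^esub> e = e" "e \<cdot>\<^bsub>T\<^esub> x = x" "fst x = fst e" for e x
    proof -
      obtain s v w where *: "e = (s, v)" "x = (s, w)" "s \<cdot> s = s"
        using e by (cases e; cases x) (auto simp: T)
      \<comment> \<open>Let \<open>+\<close> be symmetric difference and \<open>w'\<close> the
        preimage of \<open>w\<close>. For \<open>s \<in> F\<close>, \<open>e x = x\<close> gives
        \<open>v + w' = w\<close>, so the second component \<open>w + w'\<close> of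
        \<open>x x\<close> equals \<open>v\<close>. Outside \<open>F\<close> all components are
        empty.\<close>
      have "x \<cdot>\<^bsub>T\<^esub> x = e"
      proof -
        have v: "{j \<in> J. s \<in> F \<and> (j \<in> v \<longleftrightarrow> j \<cdot> s \<notin> v)} = v"
          and w: "{j \<in> J. s \<in> F \<and> (j \<in> v \<longleftrightarrow> j \<cdot> s \<notin> w)} = w"
          using e(3,4) by (simp_all add: * T)
        have "j \<in> J \<and> s \<in> F \<and> (j \<in> w \<longleftrightarrow> j \<cdot> s \<notin> w) \<longleftrightarrow> j \<in> v" for j
          using v[unfolded set_eq_iff, rule_format, of j] w[unfolded set_eq_iff, rule_format, of j]
          unfolding mem_Collect_eq by argo
        then show ?thesis by (simp add: * T)
      qed
      then show ?thesis using e(2) by blast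
    qed
  qed (auto simp: T)
  define d where "d s = {x \<in> J. s \<in> F \<and> (x \<in> U \<longleftrightarrow> x \<cdot> s \<notin> U)}" for s
  show ?thesis
  proof (rule separatedI[OF TDS, of S "\<lambda>s. (s, {})" "\<lambda>s. (s, d s)" s0])
    show "(s \<cdot> t, {}) = (s, {}) \<cdot>\<^bsub>T\<^esub> (t, {})" for s t
      by (auto simp: T)
    \<comment> \<open>\<open>d s\<close> records where membership in \<open>U\<close> changes
      between \<open>x\<close> and \<open>x s\<close>. The changes from \<open>x\<close> to
      \<open>x s\<close> and from \<open>x s\<close> to \<open>x s t\<close> add up modulo 2, and
      \<open>x s\<close> stays in \<open>J\<close>.\<close>
    show "(s \<cdot> t, d (s \<cdot> t)) = (s, d s) \<cdot>\<^bsub>T\<^esub> (t, d t)"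
      if "s \<in> carrier S" "t \<in> carrier S" for s t
    proof -
      have "j \<cdot> (s \<cdot> t) = j \<cdot> s \<cdot> t" if "j \<in> J" for j
        using \<open>s \<in> carrier S\<close> \<open>t \<in> carrier S\<close> JC[OF that] by (simp add: assoc)
      then show ?thesis using that by (auto simp: T d_def FF JF_J)
    qed
    \<comment> \<open>By \<open>UU\<close> and \<open>cancel\<close>, right multiplication by an
      element of \<open>F \<inter> U\<close> neither leaves nor enters \<open>U\<close> on
      \<open>J\<close>, so \<open>d s\<close> is empty.\<close>
    show "(s, {}) = (s, d s)" if "s \<in> U" for s
      using that cancel UU by (auto simp: d_def)
    have "x0 \<in> d s0" using x0 s0 by (simp add: d_def)
    then show "(s0, {}) \<noteq> (s0, d s0)" by auto
  qed (use semigrp_axioms FC[OF s0(1)] in \<open>auto simp: T d_def\<close>)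
qed

text \<open>If one of the two gluings is associative, it separates. Otherwise the two failures
  supply an idempotent in \<open>J\<close> and factorisations of every element of \<open>J\<close>
  through \<open>J \<inter> U\<close> on either side, as the cancellation lemmas require.\<close>

lemma separated_maximal: "separated S U"
proof (cases "right_liftable S U \<or> right_liftable (opp S) U")
  case True
  then show ?thesis
  proof
    assume "right_liftable S U"
    then show ?thesis by (rule separated_right_liftable[OF fin ifc sub proper])
  next
    assume "right_liftable (opp S) U"
    then have "separated (opp S) U"
      using fin ifc sub proper
      by (intro semigrp.separated_right_liftable semigrp_opp) (simp_all add: idem_factor_closed_opp)
    then show ?thesis by (rule separated_opp)
  qed
next
  case False
  then obtain i where i: "i \<in> J" "i \<cdot> i = i"
    and L: "\<And>x. x \<in> J \<Longrightarrow> \<exists>y\<in>J \<inter> U. \<exists>s\<in>carrier S. x = s \<cdot> y"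
    using not_right_liftableE by blast
  have "\<not> right_liftable (opp S) U" using False by simp
  from maximal_submonoid.not_right_liftableE[OF maximal_opp this]
  have R: "\<exists>y\<in>J \<inter> U. \<exists>s\<in>carrier S. x = y \<cdot> s" if "x \<in> J" for x
    using that by (auto simp: J_opp)
  obtain n where n: "n \<in> carrier S" "n \<notin> U" by (rule ex_compl)
  note nJ = compl_J[OF n]
  obtain x0 s where x0: "x0 \<in> J" "x0 \<in> U" "s \<in> carrier S" "n = x0 \<cdot> s" using R[OF nJ] by blast
  show ?thesis
  proof (rule separated_derivation[OF i _ x0(1,2) JF[OF nJ]])
    show "x \<in> U" if "x \<in> J" "u \<in> F" "u \<in> U" "x \<cdot> u \<in> U" for x u
      using L[OF that(1)] right_cancel_sub[OF i] that by blast
    \<comment> \<open>Were \<open>x0 n\<close> in \<open>U\<close>, cancelling \<open>x0\<close> on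
      the left would put \<open>n = x0 s\<close> into \<open>U\<close>.\<close>
    show "x0 \<cdot> n \<notin> U"
      using left_cancel_sub[OF i x0(4,3,1,2) JF[OF x0(1)] x0(2)] n(2) by blast
  qed
qed

end

section \<open>Adjoining an identity\<close>

text \<open>The identity is new even if \<open>S\<close> already has one, so that adding it to a
  proper subsemigroup always gives a proper submonoid.\<close>

definition adjoin_one :: "'a sgrp \<Rightarrow> 'a option sgrp" where
  "adjoin_one S = \<lparr>carrier = insert None (Some ` carrier S),
     mul = \<lambda>x y. case x of None \<Rightarrow> y | Some a \<Rightarrow>
       (case y of None \<Rightarrow> x | Some b \<Rightarrow> Some (a \<cdot>\<^bsub>S\<^esub> b))\<rparr>"

lemma adjoin_one_simps [simp]:
  "carrier (adjoin_one S) = insert None (Some ` carrier S)"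
  "None \<cdot>\<^bsub>adjoin_one S\<^esub> y = y"
  "x \<cdot>\<^bsub>adjoin_one S\<^esub> None = x"
  "Some a \<cdot>\<^bsub>adjoin_one S\<^esub> Some b = Some (a \<cdot>\<^bsub>S\<^esub> b)"
  by (auto simp: adjoin_one_def split: option.split)

context semigrp
begin

lemma semigrp_adjoin_one: "semigrp (adjoin_one S)"
  by standard (auto simp: closed assoc)

text \<open>If \<open>e\<close> is \<open>s\<close>, \<open>a s\<close> or \<open>s b\<close>, the
  missing outer factors come from \<open>e = e e e\<close>.\<close>

lemma sandwich_adjoin_one:
  assumes "e \<in> carrier S" "e \<cdot> e = e" "s \<in> carrier S"
  shows "Some e \<in> sandwich (adjoin_one S) (Some s) \<longleftrightarrow> e \<in> sandwich S s"
proof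
  assume "Some e \<in> sandwich (adjoin_one S) (Some s)"
  then consider "e = s" | a where "a \<in> carrier S" "e = a \<cdot> s" | b where "b \<in> carrier S" "e = s \<cdot> b"
    | a b where "a \<in> carrier S" "b \<in> carrier S" "e = a \<cdot> s \<cdot> b"
    by (auto simp: sandwich_def)
  then show "e \<in> sandwich S s"
  proof cases
    case 1 then show ?thesis using sandwich_idem assms by blast
  next
    case 2 then show ?thesis using sandwich_factors(2) sandwich_idem assms by metis
  next
    case 3 then show ?thesis using sandwich_factors(1) sandwich_idem assms by metis
  next
    case 4 then show ?thesis by (rule sandwichI)
  qed
next
  assume "e \<in> sandwich S s"
  then obtain a b where "a \<in> carrier S" "b \<in> carrier S" "e = a \<cdot> s \<cdot> b" by (rule sandwichE)
  then show "Some e \<in> sandwich (adjoin_one S) (Some s)"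
    by (intro semigrp.sandwichI[OF semigrp_adjoin_one, of "Some a" "Some b"]) auto
qed

lemma idem_factor_closed_adjoin_one:
  assumes "idem_factor_closed S"
  shows "idem_factor_closed (adjoin_one S)"
proof -
  have one: "None \<notin> sandwich (adjoin_one S) (Some s)" for s
    by (auto simp: sandwich_def adjoin_one_def split: option.splits)
  show ?thesis
    unfolding idem_factor_closed_def
  proof (intro ballI impI)
    fix e s t
    assume "e \<in> carrier (adjoin_one S)" "s \<in> carrier (adjoin_one S)" "t \<in> carrier (adjoin_one S)"
      and "e \<cdot>\<^bsub>adjoin_one S\<^esub> e = e"
      and "e \<in> sandwich (adjoin_one S) s" "e \<in> sandwich (adjoin_one S) t"
    then show "e \<in> sandwich (adjoin_one S) (s \<cdot>\<^bsub>adjoin_one S\<^esub> t)"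
      using assms
      by (cases e; cases s; cases t)
        (auto simp: one sandwich_adjoin_one closed idem_factor_closed_def image_iff)
  qed
qed

text \<open>The separating pair agrees at the identity, hence differs on \<open>S\<close>, and its
  restrictions to \<open>S\<close> remain distinct.\<close>

lemma separated_adjoin_one:
  assumes "separated (adjoin_one S) V" "None \<in> V" "Some ` U \<subseteq> V" "U \<subseteq> carrier S"
  shows "separated S U"
proof -
  obtain R :: "nat sgrp" and \<beta> \<gamma> where R: "R \<in> DS"
    and \<beta>: "\<beta> \<in> sgrp_hom (adjoin_one S) R" and \<gamma>: "\<gamma> \<in> sgrp_hom (adjoin_one S) R"
    and ne: "\<beta> \<noteq> \<gamma>" and agree: "\<forall>x\<in>V. \<beta> x = \<gamma> x"
    using assms(1) by (auto simp: separated_def)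
  have hom: "(\<lambda>x\<in>carrier S. \<delta> (Some x)) \<in> sgrp_hom S R"
    if "\<delta> \<in> sgrp_hom (adjoin_one S) R" for \<delta>
    using that by (auto simp: sgrp_hom_def closed)
  have "\<exists>x\<in>carrier (adjoin_one S). \<beta> x \<noteq> \<gamma> x"
  proof (rule ccontr)
    assume "\<not> ?thesis"
    moreover have "\<beta> \<in> carrier (adjoin_one S) \<rightarrow>\<^sub>E carrier R" "\<gamma> \<in> carrier (adjoin_one S) \<rightarrow>\<^sub>E carrier R"
      using \<beta> \<gamma> unfolding sgrp_hom_def by blast+
    ultimately have "\<beta> = \<gamma>" by (intro PiE_ext) blast+
    with ne show False ..
  qed
  then obtain x where x: "x \<in> carrier S" "\<beta> (Some x) \<noteq> \<gamma> (Some x)"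
    using agree assms(2) by auto
  then have "(\<lambda>x\<in>carrier S. \<beta> (Some x)) \<noteq> (\<lambda>x\<in>carrier S. \<gamma> (Some x))"
    by (metis restrict_apply')
  moreover have "\<forall>x\<in>U. (\<lambda>x\<in>carrier S. \<beta> (Some x)) x = (\<lambda>x\<in>carrier S. \<gamma> (Some x)) x"
    using agree assms(3,4) by auto
  ultimately show ?thesis
    unfolding separated_def using R hom[OF \<beta>] hom[OF \<gamma>] by blast
qed

end

text \<open>By finiteness, \<open>U\<close> with the new identity lies in a maximal proper submonoid
  \<open>V\<close> of \<open>adjoin_one S\<close>. Homomorphisms that agree on \<open>V\<close>
  agree on \<open>U\<close>.\<close>

lemma DS_separated:
  assumes S: "S \<in> DS" and U: "subsemigroup U S" "U \<noteq> carrier S"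
  shows "separated S U"
proof -
  note S' = DS_D[OF S]
  interpret semigrp S by (rule S')
  let ?S = "adjoin_one S"
  let ?A = "{V. subsemigroup V ?S \<and> V \<noteq> carrier ?S}"
  let ?U = "insert None (Some ` U)"
  have "finite (Pow (carrier ?S))" using S'(2) by simp
  moreover have "?A \<subseteq> Pow (carrier ?S)" by (auto simp: subsemigroup_def)
  ultimately have "finite ?A" using finite_subset by blast
  moreover have "?U \<in> ?A"
  proof -
    obtain x where "x \<in> carrier S" "x \<notin> U" using U by (auto simp: subsemigroup_def)
    then have "Some x \<in> carrier ?S" "Some x \<notin> ?U" by auto
    then have "?U \<noteq> carrier ?S" by blast
    moreover have "subsemigroup ?U ?S" using U(1) by (auto simp: subsemigroup_def)
    ultimately show ?thesis by blast
  qed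
  ultimately obtain V where V: "V \<in> ?A" "?U \<subseteq> V" and max: "\<forall>W\<in>?A. V \<subseteq> W \<longrightarrow> V = W"
    using finite_has_maximal2[of ?A ?U] by blast
  have "maximal_submonoid ?S None V"
  proof (intro maximal_submonoid.intro semigrp_adjoin_one maximal_submonoid_axioms.intro)
    show "idem_factor_closed ?S" using S'(3) by (rule idem_factor_closed_adjoin_one)
    show "W = V \<or> W = carrier ?S" if "subsemigroup W ?S" "V \<subseteq> W" for W
      using max that by auto
  qed (use S'(2) V in auto)
  then have "separated ?S V" by (rule maximal_submonoid.separated_maximal)
  then show ?thesis
    using V(2) U(1) by (intro separated_adjoin_one) (auto simp: subsemigroup_def)
qed

theorem theorem3p1:
  fixes S :: "'a sgrp" and U :: "'a set"
  assumes "S \<in> DS"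
    and "subsemigroup U S"
    and "U \<noteq> carrier S"
  shows "\<not> DS_epi (S\<lparr>carrier := U\<rparr>) S (\<lambda>x\<in>U. x) \<and>
    (\<exists>R \<in> (DS :: nat sgrp set). \<exists>\<beta> \<in> sgrp_hom S R. \<exists>\<gamma> \<in> sgrp_hom S R.
       \<beta> \<noteq> \<gamma> \<and> (\<forall>x\<in>U. \<beta> x = \<gamma> x))"
proof -
  have sep: "\<exists>R \<in> (DS :: nat sgrp set). \<exists>\<beta> \<in> sgrp_hom S R. \<exists>\<gamma> \<in> sgrp_hom S R.
       \<beta> \<noteq> \<gamma> \<and> (\<forall>x\<in>U. \<beta> x = \<gamma> x)"
    using DS_separated[OF assms] unfolding separated_def .
  have "compose U \<beta> (\<lambda>x\<in>U. x) = compose U \<gamma> (\<lambda>x\<in>U. x)"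
    if "\<forall>x\<in>U. \<beta> x = \<gamma> x" for \<beta> \<gamma> :: "'a \<Rightarrow> nat"
    using that by (auto simp: compose_def restrict_def)
  with sep have "\<not> DS_epi (S\<lparr>carrier := U\<rparr>) S (\<lambda>x\<in>U. x)"
    unfolding DS_epi_def by (simp, metis)
  with sep show ?thesis by blast
qed

end
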